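(* Let $s\in(0,1)$, let $\Omega\subset\mathbb{R}^N$ be a bounded open domain with Lipschitz boundary, and let $f\in L^2(\Omega)$. For $\delta>0$ let $u^{\delta,s}\in\mathbb{H}_0^{\delta,s}(\Omega)$ be the weak solution of $$(-\Delta)_\delta^s u=f\ \text{ in }\Omega,\qquad u=0\ \text{ on }\partial_\delta\Omega,$$ and let $u^{\infty,s}\in\mathcal{H}_0^s(\Omega)$ be the weak solution of $$(-\Delta)_\infty^s u=f\ \text{ in }\Omega,\qquad u=0\ \text{ on }\mathbb{R}^N\setminus\Omega .$$ Then, up to a subsequence, $u^{\delta,s}\to u^{\infty,s}$ in $L^2(\Omega)$ as $\delta\to+\infty$; that is, every sequence $\delta_j\to+\infty$ has a subsequence along which $u^{\delta_j,s}\to u^{\infty,s}$ in $L^2(\Omega)$.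
   Context: For $\delta>0$: $\partial_\delta\Omega=\{y\in\mathbb{R}^N\setminus\Omega:\ |x-y|<\delta\text{ for some }x\in\Omega\}$ and $\Omega_\delta=\Omega\cup\partial_\delta\Omega$. The constant is $c_{N,s}=\dfrac{2^{2s}s\,\Gamma(\frac N2+s)}{\pi^{N/2}\Gamma(1-s)}$. The operators are $(-\Delta)_\delta^s u(x)=c_{N,s}\,\mathrm{P.V.}\int_{B(x,\delta)}\frac{u(x)-u(y)}{|x-y|^{N+2s}}dy$ and $(-\Delta)_\infty^s u(x)=c_{N,s}\,\mathrm{P.V.}\int_{\mathbb{R}^N}\frac{u(x)-u(y)}{|x-y|^{N+2s}}dy$ (the fractional Laplacian). The space $\mathbb{H}_0^{\delta,s}(\Omega)$ is the set of $v\in L^2(\Omega_\delta)$ with $v=0$ a.e. on $\partial_\delta\Omega$ and $\int_{\Omega_\delta}\int_{\Omega_\delta\cap B(x,\delta)}\frac{|v(x)-v(y)|^2}{|x-y|^{N+2s}}dydx<\infty$. The space $\mathcal{H}_0^s(\Omega)$ is the set of $v\in H^s(\mathbb{R}^N)$ with $v=0$ a.e. on $\mathbb{R}^N\setminus\Omega$. A weak solution of the first problem is $u\in\mathbb{H}_0^{\delta,s}(\Omega)$ such that for all $v\in\mathbb{H}_0^{\delta,s}(\Omega)$ $$\frac{c_{N,s}}{2}\int_{\Omega_\delta}\int_{\Omega_\delta\cap B(x,\delta)}\frac{(u(x)-u(y))(v(x)-v(y))}{|x-y|^{N+2s}}\,dy\,dx=\int_\Omega f v\,dx .$$ A weak solution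 of the second problem is $u\in\mathcal{H}_0^s(\Omega)$ such that for all $v\in\mathcal{H}_0^s(\Omega)$ $$\frac{c_{N,s}}{2}\int_{\mathbb{R}^N}\int_{\mathbb{R}^N}\frac{(u(x)-u(y))(v(x)-v(y))}{|x-y|^{N+2s}}\,dy\,dx=\int_\Omega f v\,dx .$$ Both exist and are unique. *)

theory Defs
  imports "HOL-Analysis.Analysis"
begin

text \<open>
  The space \<open>R^N\<close> is an arbitrary Euclidean space \<open>'a\<close> with \<open>N = DIM('a)\<close>. Elements of
  \<open>L\<^sup>2\<close>-type spaces over a set \<open>A\<close> are represented by total functions whose values
  outside \<open>A\<close> play no role; equality of such elements is equality almost everywhere.
\<close>

definition L2 :: "'a::euclidean_space set \<Rightarrow> ('a \<Rightarrow> real) set" where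
  "L2 A = {v. v \<in> borel_measurable (lebesgue_on A) \<and> integrable (lebesgue_on A) (\<lambda>x. (v x)\<^sup>2)}"

definition L2_norm :: "'a::euclidean_space set \<Rightarrow> ('a \<Rightarrow> real) \<Rightarrow> real" where
  "L2_norm A v = sqrt (LINT x|lebesgue_on A. (v x)\<^sup>2)"

text \<open>
  Near each boundary point \<open>\<Omega>\<close> is the strict epigraph, in the direction of some unit vector
  \<open>e\<close>, of a Lipschitz function on the hyperplane orthogonal to \<open>e\<close>. Choosing \<open>e\<close> amounts to
  choosing the usual rotated coordinate system; \<open>x - (x \<bullet> e) *\<^sub>R e\<close> plays the role of the first
  \<open>N - 1\<close> coordinates of \<open>x\<close> and \<open>x \<bullet> e\<close> that of the last one.
\<close>

definition lipschitz_boundary :: "'a::euclidean_space set \<Rightarrow> bool" where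
  "lipschitz_boundary \<Omega> \<longleftrightarrow>
     (\<forall>p\<in>frontier \<Omega>. \<exists>r>0. \<exists>e g L. norm e = 1 \<and>
        L-lipschitz_on {z. z \<bullet> e = 0} (g :: 'a \<Rightarrow> real) \<and>
        \<Omega> \<inter> ball p r = {x \<in> ball p r. g (x - (x \<bullet> e) *\<^sub>R e) < x \<bullet> e})"

definition c_const :: "nat \<Rightarrow> real \<Rightarrow> real" where
  "c_const N s = 2 powr (2 * s) * s * Gamma (real N / 2 + s) / (pi powr (real N / 2) * Gamma (1 - s))"

definition nonlocal_boundary :: "real \<Rightarrow> 'a::euclidean_space set \<Rightarrow> 'a set" where
  "nonlocal_boundary \<delta> \<Omega> = {y. y \<notin> \<Omega> \<and> (\<exists>x\<in>\<Omega>. norm (x - y) < \<delta>)}"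

definition extended_domain :: "real \<Rightarrow> 'a::euclidean_space set \<Rightarrow> 'a set" where
  "extended_domain \<delta> \<Omega> = \<Omega> \<union> nonlocal_boundary \<delta> \<Omega>"

text \<open>
  On the diagonal \<open>x = y\<close> the quotients below are \<open>0 / 0 = 0\<close>, which is harmless
  because \<open>{x}\<close> is a null set. Finiteness of an energy is stated with the \<open>ennreal\<close>-valued integral,
  since the Bochner integral of a nonintegrable function is \<open>0\<close> by convention.
\<close>

definition H0_delta :: "real \<Rightarrow> real \<Rightarrow> 'a::euclidean_space set \<Rightarrow> ('a \<Rightarrow> real) set" where
  "H0_delta \<delta> s \<Omega> =
     {v \<in> L2 (extended_domain \<delta> \<Omega>).
        (AE x in lebesgue. x \<in> nonlocal_boundary \<delta> \<Omega> \<longrightarrow> v x = 0) \<and>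
        (\<integral>\<^sup>+x\<in>extended_domain \<delta> \<Omega>.
           (\<integral>\<^sup>+y\<in>extended_domain \<delta> \<Omega> \<inter> ball x \<delta>.
              ennreal (\<bar>v x - v y\<bar>\<^sup>2 / norm (x - y) powr (real DIM('a) + 2 * s)) \<partial>lebesgue) \<partial>lebesgue) < \<infinity>}"

definition Hs :: "real \<Rightarrow> ('a::euclidean_space \<Rightarrow> real) set" where
  "Hs s =
     {v \<in> L2 UNIV.
        (\<integral>\<^sup>+x. (\<integral>\<^sup>+y. ennreal (\<bar>v x - v y\<bar>\<^sup>2 / norm (x - y) powr (real DIM('a) + 2 * s))
           \<partial>lebesgue) \<partial>lebesgue) < \<infinity>}"

definition H0 :: "real \<Rightarrow> 'a::euclidean_space set \<Rightarrow> ('a \<Rightarrow> real) set" where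
  "H0 s \<Omega> = {v \<in> Hs s. AE x in lebesgue. x \<in> - \<Omega> \<longrightarrow> v x = 0}"

definition weak_solution_delta ::
    "real \<Rightarrow> real \<Rightarrow> 'a::euclidean_space set \<Rightarrow> ('a \<Rightarrow> real) \<Rightarrow> ('a \<Rightarrow> real) \<Rightarrow> bool" where
  "weak_solution_delta \<delta> s \<Omega> f u \<longleftrightarrow>
     u \<in> H0_delta \<delta> s \<Omega> \<and>
     (\<forall>v\<in>H0_delta \<delta> s \<Omega>.
        c_const DIM('a) s / 2 *
          (LINT x:extended_domain \<delta> \<Omega>|lebesgue.
             (LINT y:extended_domain \<delta> \<Omega> \<inter> ball x \<delta>|lebesgue.
                (u x - u y) * (v x - v y) / norm (x - y) powr (real DIM('a) + 2 * s)))
        = (LINT x:\<Omega>|lebesgue. f x * v x))"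

definition weak_solution_infinity ::
    "real \<Rightarrow> 'a::euclidean_space set \<Rightarrow> ('a \<Rightarrow> real) \<Rightarrow> ('a \<Rightarrow> real) \<Rightarrow> bool" where
  "weak_solution_infinity s \<Omega> f u \<longleftrightarrow>
     u \<in> H0 s \<Omega> \<and>
     (\<forall>v\<in>H0 s \<Omega>.
        c_const DIM('a) s / 2 *
          (LINT x|lebesgue. (LINT y|lebesgue.
             (u x - u y) * (v x - v y) / norm (x - y) powr (real DIM('a) + 2 * s)))
        = (LINT x:\<Omega>|lebesgue. f x * v x))"

end

(* Only pairs with a point in \<Omega> contribute to the energies, so for \<delta> larger than the diameter
   of \<Omega> the truncated form differs from the full one just by 2 C(\<delta>) <u, v>, where C(\<delta>) is the
   mass of |z|^(-N-2s) on |z| >= \<delta>.  Testing both equations with w = u_\<delta> - u_\<infinity> gives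
   E(w, w) = 2 C(\<delta>) <u_\<delta>, w>, while discarding the part of E near the diagonal gives the
   Poincare inequality E(w, w) >= 2 C(D) |w|^2 with D > diam \<Omega> fixed.  Together these bound
   |w|^2 by C(\<delta>) |u_\<infinity>|^2 / (2 C(D) - 3 C(\<delta>)), and C(\<delta>) tends to 0: the whole family
   converges, and no compactness is needed. *)

theory Submission
  imports Defs
begin

subsection \<open>The kernel away from the diagonal\<close>

text \<open>Kept as a function of the difference alone, so that translation and reflection
  invariance of Lebesgue measure make the mass seen from a point \<open>x\<close> independent of
  \<open>x\<close>.\<close>

definition kernel_tail :: "real \<Rightarrow> real \<Rightarrow> 'a::euclidean_space \<Rightarrow> real" where
  "kernel_tail s \<delta> z = indicator {z. \<delta> \<le> norm z} z / norm z powr (real DIM('a) + 2 * s)"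

lemma borel_measurable_kernel_tail [measurable]:
  "(kernel_tail s \<delta> :: 'a::euclidean_space \<Rightarrow> real) \<in> borel_measurable borel"
  unfolding kernel_tail_def by measurable

lemma kernel_tail_nonneg [simp]: "0 \<le> kernel_tail s \<delta> z"
  by (simp add: kernel_tail_def)

lemma ex_dyadic_interval:
  fixes t :: real
  assumes "1 \<le> t"
  shows "\<exists>k. 2 ^ k \<le> t \<and> t < 2 ^ Suc k"
proof -
  obtain n where n: "t < 2 ^ n" using real_arch_pow[of 2 t] by auto
  define m where "m = (LEAST n. t < 2 ^ n)"
  have m: "t < 2 ^ m" unfolding m_def by (rule LeastI, rule n)
  with assms obtain k where k: "m = Suc k" by (cases m) auto
  then have "\<not> t < 2 ^ k" unfolding m_def by (metis lessI not_less_Least)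
  with m k show ?thesis by (intro exI[of _ k]) auto
qed

text \<open>Dyadic shells: for 2^k \<delta> \<le> |z| < 2^(k+1) \<delta> the kernel is at most (2^k
  \<delta>)^(-N-2s), while a ball of radius 2^(k+1) \<delta> has volume proportional to (2^k
  \<delta>)^N. The products form a geometric series of ratio 2^(-2s) < 1.\<close>

lemma integrable_kernel_tail:
  assumes s: "0 < s" and d: "0 < \<delta>"
  shows "integrable lborel (kernel_tail s \<delta> :: 'a::euclidean_space \<Rightarrow> real)"
proof -
  let ?N = "DIM('a)"
  let ?p = "real ?N + 2 * s"
  define a where "a k = (2 ^ k * \<delta>) powr - ?p" for k :: nat
  \<comment> \<open>Whole balls stand in for the shells: the overlap only enlarges the majorant, and
    the volume of a ball is explicit.\<close>
  define B where "B k = ball (0::'a) (2 ^ Suc k * \<delta>)" for k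
  define V where "V = unit_ball_vol (real ?N) * 2 ^ ?N * \<delta> powr (- 2 * s)"
  define q where "q = (2::real) powr (- 2 * s)"
  have V: "0 \<le> V" by (simp add: V_def)
  have q: "0 \<le> q" "q < 1" using s by (auto simp: q_def intro: powr_less_one)
  have a0: "0 \<le> a k" for k by (simp add: a_def)
  have [measurable]: "B k \<in> sets borel" for k by (simp add: B_def)
  have le: "ennreal (kernel_tail s \<delta> z) \<le> (\<Sum>k. ennreal (a k) * indicator (B k) z)" for z :: 'a
  proof (cases "\<delta> \<le> norm z")
    case True
    then have "1 \<le> norm z / \<delta>" using d by simp
    then obtain k where k: "2 ^ k \<le> norm z / \<delta>" "norm z / \<delta> < 2 ^ Suc k"
      using ex_dyadic_interval by blast
    then have k': "2 ^ k * \<delta> \<le> norm z" "norm z < 2 ^ Suc k * \<delta>"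
      using d by (auto simp: field_simps)
    have "kernel_tail s \<delta> z = norm z powr - ?p"
      using True by (simp add: kernel_tail_def powr_minus divide_inverse del: minus_add_distrib)
    also have "\<dots> \<le> a k" unfolding a_def using k' d s by (intro powr_mono2') auto
    finally have "ennreal (kernel_tail s \<delta> z) \<le> ennreal (a k) * indicator (B k) z"
      using k' by (simp add: B_def ennreal_leI)
    also have "\<dots> \<le> (\<Sum>k. ennreal (a k) * indicator (B k) z)"
      using sum_le_suminf[of "\<lambda>k. ennreal (a k) * indicator (B k) z" "{k}"] by (auto simp del: sum_mult_indicator sum_indicator_mult)
    finally show ?thesis .
  next
    case False
    then show ?thesis by (simp add: kernel_tail_def)
  qed
  have coeff: "a k * (unit_ball_vol (real ?N) * (2 ^ Suc k * \<delta>) ^ ?N) = V * q ^ k" for k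
  proof -
    have "((2::real) ^ k) powr (- 2 * s) = q ^ k"
      unfolding q_def by (simp add: powr_powr powr_power mult_ac flip: powr_realpow)
    moreover have "a k * (2 ^ k * \<delta>) powr real ?N = (2 ^ k * \<delta>) powr (- 2 * s)"
      unfolding a_def by (simp flip: powr_add)
    ultimately have "a k * (2 ^ k * \<delta>) powr real ?N = \<delta> powr (- 2 * s) * q ^ k"
      using d by (simp only: powr_mult) simp
    moreover have "a k * (unit_ball_vol (real ?N) * (2 ^ Suc k * \<delta>) ^ ?N)
        = unit_ball_vol (real ?N) * 2 ^ ?N * (a k * (2 ^ k * \<delta>) powr real ?N)"
      using d by (simp add: powr_realpow power_mult_distrib)
    ultimately show ?thesis by (simp add: V_def)
  qed
  have "(\<integral>\<^sup>+z. ennreal (kernel_tail s \<delta> (z::'a)) \<partial>lborel)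
      \<le> (\<integral>\<^sup>+z. (\<Sum>k. ennreal (a k) * indicator (B k) z) \<partial>lborel)"
    by (intro nn_integral_mono le)
  also have "\<dots> = (\<Sum>k. \<integral>\<^sup>+z. ennreal (a k) * indicator (B k) z \<partial>lborel)"
    by (rule nn_integral_suminf) measurable
  also have "\<dots> = (\<Sum>k. ennreal (V * q ^ k))"
  proof (rule suminf_cong)
    fix k
    have "(\<integral>\<^sup>+z. ennreal (a k) * indicator (B k) z \<partial>lborel) = ennreal (a k) * emeasure lborel (B k)"
      by (rule nn_integral_cmult_indicator) simp
    also have "\<dots> = ennreal (V * q ^ k)"
      using d a0[of k] unfolding coeff[symmetric] B_def
      by (subst emeasure_ball) (auto simp flip: ennreal_mult)
    finally show "(\<integral>\<^sup>+z. ennreal (a k) * indicator (B k) z \<partial>lborel) = ennreal (V * q ^ k)" .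
  qed
  also have "\<dots> = ennreal (\<Sum>k. V * q ^ k)"
    using q V by (intro suminf_ennreal2 summable_mult summable_geometric) auto
  also have "\<dots> < \<infinity>" by simp
  finally show ?thesis by (intro integrableI_nonneg) auto
qed

text \<open>The mass depends on the space only through its dimension, which the two real arguments
  do not determine; the \<open>itself\<close> argument fixes the type.\<close>

definition tail_mass :: "'a::euclidean_space itself \<Rightarrow> real \<Rightarrow> real \<Rightarrow> real" where
  "tail_mass _ s \<delta> = (LINT z|lborel. kernel_tail s \<delta> (z::'a))"

lemma tail_mass_nonneg: "0 \<le> tail_mass T s \<delta>"
  by (simp add: tail_mass_def)

text \<open>Dominated convergence: the tail at radius 1 is an integrable majorant for every
  \<open>\<delta>\<close> \<ge> 1, and at a fixed point the tail is zero once
  \<open>\<delta>\<close> exceeds the norm.\<close>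

lemma tail_mass_tendsto_0:
  assumes s: "0 < s"
  shows "(tail_mass TYPE('a::euclidean_space) s \<longlongrightarrow> 0) at_top"
proof -
  have "((\<lambda>\<delta>. LINT z|lborel. kernel_tail s \<delta> (z::'a)) \<longlongrightarrow> (LINT z|(lborel :: 'a measure). 0)) at_top"
  proof (rule integral_dominated_convergence_at_top[where w = "kernel_tail s 1"])
    show "integrable lborel (kernel_tail s 1 :: 'a \<Rightarrow> real)"
      by (rule integrable_kernel_tail) (use s in auto)
    show "AE z in lborel. ((\<lambda>\<delta>. kernel_tail s \<delta> (z::'a)) \<longlongrightarrow> 0) at_top"
    proof (rule AE_I2)
      fix z :: 'a
      have "\<forall>\<^sub>F \<delta> in at_top. kernel_tail s \<delta> z = 0"
        using eventually_gt_at_top[of "norm z"] by eventually_elim (simp add: kernel_tail_def)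
      then show "((\<lambda>\<delta>. kernel_tail s \<delta> z) \<longlongrightarrow> 0) at_top"
        by (rule tendsto_eventually)
    qed
    show "\<forall>\<^sub>F \<delta> in at_top. AE z in lborel. norm (kernel_tail s \<delta> (z::'a)) \<le> kernel_tail s 1 z"
      using eventually_ge_at_top[of 1]
      by eventually_elim (auto simp: kernel_tail_def split: split_indicator)
  qed auto
  then show ?thesis by (simp add: tail_mass_def[abs_def])
qed

text \<open>The unit ball centred at distance \<open>\<delta>\<close> + 1 from the origin has
  positive measure, and the kernel is positive on it. This makes the constant in the Poincare
  inequality nontrivial.\<close>

lemma tail_mass_pos:
  assumes s: "0 < s" and d: "0 < \<delta>"
  shows "0 < tail_mass TYPE('a::euclidean_space) s \<delta>"
proof -
  obtain b :: 'a where b: "b \<in> Basis" using nonempty_Basis by blast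
  define p where "p = (\<delta> + 1) *\<^sub>R b"
  have p: "norm p = \<delta> + 1" using b d by (simp add: p_def)
  have far: "\<delta> < norm z" if "z \<in> ball p 1" for z
    using norm_triangle_ineq2[of p z] that p by (simp add: dist_norm)
  have "tail_mass TYPE('a) s \<delta> \<noteq> 0"
  proof
    assume "tail_mass TYPE('a) s \<delta> = 0"
    then have "AE z in lborel. kernel_tail s \<delta> (z::'a) = 0"
      using integral_nonneg_eq_0_iff_AE[OF integrable_kernel_tail[OF s d, where 'a = 'a]]
      by (simp add: tail_mass_def)
    then have "AE z in lborel. z \<notin> ball p 1"
      by eventually_elim (use far d in \<open>fastforce simp: kernel_tail_def indicator_def split: if_splits\<close>)
    then have "emeasure lborel (ball p 1) = 0"
      by (subst (asm) AE_iff_measurable[where N = "ball p 1"]) auto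
    then show False using unit_ball_vol_pos[of "real DIM('a)"] by (simp add: emeasure_ball)
  qed
  then show ?thesis using tail_mass_nonneg by (metis less_eq_real_def)
qed

subsection \<open>The Gagliardo form on functions vanishing off \<Omega>\<close>

lemma sigma_finite_lebesgue: "sigma_finite_measure (lebesgue :: 'a::euclidean_space measure)"
proof -
  obtain A :: "'a set set" where A: "countable A" "A \<subseteq> sets lborel" "\<Union>A = space lborel"
    "\<forall>a\<in>A. emeasure lborel a \<noteq> \<infinity>"
    using lborel.sigma_finite_countable by blast
  then show ?thesis by (intro sigma_finite_measure.intro exI[of _ A]) auto
qed

interpretation leb: sigma_finite_measure "lebesgue :: 'a::euclidean_space measure"
  by (rule sigma_finite_lebesgue)

interpretation leb_pair: pair_sigma_finite
  "lebesgue :: 'a::euclidean_space measure" "lebesgue :: 'b::euclidean_space measure" ..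

text \<open>The product of two completed measures, not Lebesgue measure on the product space: the
  iterated \<open>lebesgue\<close> integrals in the definitions become integrals over it by Fubini
  and Tonelli.\<close>

abbreviation leb2 :: "('a::euclidean_space \<times> 'a) measure" where
  "leb2 \<equiv> lebesgue \<Otimes>\<^sub>M lebesgue"

lemma measurable_diff_leb2 [measurable]:
  "(\<lambda>p. fst p - snd p) \<in> (leb2 :: ('a::euclidean_space \<times> 'a) measure) \<rightarrow>\<^sub>M borel"
proof -
  have i: "(\<lambda>x. x) \<in> (lebesgue :: 'a measure) \<rightarrow>\<^sub>M borel"
    by (rule measurable_completion) simp
  show ?thesis
    by (intro borel_measurable_diff measurable_compose[OF measurable_fst i]
        measurable_compose[OF measurable_snd i])
qed

lemma lborel_distr_reflect: "distr lborel borel (\<lambda>y. x - y) = (lborel :: 'a::euclidean_space measure)"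
  using lborel_affine[of "-1" x] by (simp add: density_1)

lemma kernel_tail_reflected:
  assumes "0 < s" "0 < \<delta>"
  shows "integrable lebesgue (\<lambda>y. kernel_tail s \<delta> (x - y :: 'a::euclidean_space))"
    and "(LINT y|lebesgue. kernel_tail s \<delta> (x - y)) = tail_mass TYPE('a) s \<delta>"
proof -
  have "integrable (distr lborel borel (\<lambda>y. x - y)) (kernel_tail s \<delta>)"
    unfolding lborel_distr_reflect using integrable_kernel_tail[OF assms] .
  then show "integrable lebesgue (\<lambda>y. kernel_tail s \<delta> (x - y))"
    by (simp add: integrable_completion integrable_distr_eq)
  have "tail_mass TYPE('a) s \<delta> = integral\<^sup>L (distr lborel borel (\<lambda>y. x - y)) (kernel_tail s \<delta>)"
    unfolding lborel_distr_reflect tail_mass_def ..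
  also have "\<dots> = (LINT y|lborel. kernel_tail s \<delta> (x - y))"
    by (rule integral_distr) auto
  finally show "(LINT y|lebesgue. kernel_tail s \<delta> (x - y)) = tail_mass TYPE('a) s \<delta>"
    by (simp add: integral_completion)
qed

lemma kernel_tail_minus_commute: "kernel_tail s \<delta> (x - y) = kernel_tail s \<delta> (y - x)"
  by (simp add: kernel_tail_def norm_minus_commute indicator_def)

text \<open>Integrating first in the variable on which \<open>G\<close> does not depend produces the
  tail mass as a factor. The \<open>snd\<close> versions follow by swapping the variables, since the
  kernel is even.\<close>

lemma kernel_tail_product:
  fixes G :: "'a::euclidean_space \<Rightarrow> real"
  assumes s: "0 < s" "0 < \<delta>" and G: "integrable lebesgue G"
  shows integrable_kernel_tail_fst: "integrable leb2 (\<lambda>p. G (fst p) * kernel_tail s \<delta> (fst p - snd p))"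
    and integral_kernel_tail_fst: "(LINT p|leb2. G (fst p) * kernel_tail s \<delta> (fst p - snd p))
          = tail_mass TYPE('a) s \<delta> * (LINT x|lebesgue. G x)"
    and integrable_kernel_tail_snd: "integrable leb2 (\<lambda>p. G (snd p) * kernel_tail s \<delta> (fst p - snd p))"
    and integral_kernel_tail_snd: "(LINT p|leb2. G (snd p) * kernel_tail s \<delta> (fst p - snd p))
          = tail_mass TYPE('a) s \<delta> * (LINT x|lebesgue. G x)"
proof -
  have [measurable]: "G \<in> borel_measurable lebesgue" using G by auto
  let ?F = "\<lambda>p. G (fst p) * kernel_tail s \<delta> (fst p - snd p)"
  have [measurable]: "?F \<in> borel_measurable leb2" by measurable
  show 1: "integrable leb2 ?F"
  proof (rule leb_pair.Fubini_integrable)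
    show "integrable lebesgue (\<lambda>x. LINT y|lebesgue. norm (?F (x, y)))"
      using G by (simp add: abs_mult kernel_tail_reflected[OF s])
    show "AE x in lebesgue. integrable lebesgue (\<lambda>y. ?F (x, y))"
      by (simp add: kernel_tail_reflected[OF s])
  qed simp
  show 2: "(LINT p|leb2. ?F p) = tail_mass TYPE('a) s \<delta> * (LINT x|lebesgue. G x)"
    using leb_pair.integral_fst'[OF 1] by (simp add: kernel_tail_reflected[OF s] mult.commute)
  have swap: "(\<lambda>p. G (snd p) * kernel_tail s \<delta> (fst p - snd p)) = (\<lambda>(x, y). ?F (y, x))"
    by (auto simp: kernel_tail_minus_commute)
  show "integrable leb2 (\<lambda>p. G (snd p) * kernel_tail s \<delta> (fst p - snd p))"
    unfolding swap by (rule leb_pair.integrable_product_swap[OF 1])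
  show "(LINT p|leb2. G (snd p) * kernel_tail s \<delta> (fst p - snd p))
      = tail_mass TYPE('a) s \<delta> * (LINT x|lebesgue. G x)"
    unfolding swap using leb_pair.integral_product_swap[of ?F] 2 by simp
qed

section \<open>The Gagliardo integrand and functions of finite energy\<close>

definition gagliardo ::
    "real \<Rightarrow> ('a::euclidean_space \<Rightarrow> real) \<Rightarrow> ('a \<Rightarrow> real) \<Rightarrow> 'a \<times> 'a \<Rightarrow> real" where
  "gagliardo s u v p = (u (fst p) - u (snd p)) * (v (fst p) - v (snd p)) /
     norm (fst p - snd p) powr (real DIM('a) + 2 * s)"

lemma measurable_gagliardo [measurable]:
  assumes [measurable]: "u \<in> borel_measurable lebesgue" "v \<in> borel_measurable lebesgue"
  shows "gagliardo s u v \<in> borel_measurable leb2"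
  unfolding gagliardo_def[abs_def] by measurable

lemma gagliardo_self_nonneg [simp]: "0 \<le> gagliardo s u u p"
  by (simp add: gagliardo_def)

lemma gagliardo_diff_left: "gagliardo s (\<lambda>x. u x - v x) w p = gagliardo s u w p - gagliardo s v w p"
  by (simp add: gagliardo_def left_diff_distrib diff_divide_distrib[symmetric])

lemma gagliardo_commute: "gagliardo s u v = gagliardo s v u"
  by (simp add: gagliardo_def[abs_def] mult.commute)

lemma gagliardo_diff_right: "gagliardo s w (\<lambda>x. u x - v x) p = gagliardo s w u p - gagliardo s w v p"
  using gagliardo_diff_left[of s u v w p] by (simp only: gagliardo_commute[of s w])

lemma abs_mult_le_sum_squares: "\<bar>a * b\<bar> \<le> a\<^sup>2 + b\<^sup>2" for a b :: real
proof -
  have "2 * (\<bar>a\<bar> * \<bar>b\<bar>) \<le> a\<^sup>2 + b\<^sup>2"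
    using sum_squares_bound[of "\<bar>a\<bar>" "\<bar>b\<bar>"] by simp
  moreover have "0 \<le> \<bar>a\<bar> * \<bar>b\<bar>" by simp
  ultimately show ?thesis unfolding abs_mult by linarith
qed

lemma abs_gagliardo_le: "\<bar>gagliardo s u v p\<bar> \<le> gagliardo s u u p + gagliardo s v v p"
proof -
  have "\<bar>a * b\<bar> / k \<le> a\<^sup>2 / k + b\<^sup>2 / k" if "0 \<le> k" for a b k :: real
    using divide_right_mono[OF abs_mult_le_sum_squares that] by (simp flip: add_divide_distrib)
  then show ?thesis by (simp add: gagliardo_def power2_eq_square)
qed

lemma integrable_mult_squares:
  fixes u v :: "'a \<Rightarrow> real"
  assumes [measurable]: "u \<in> borel_measurable M" "v \<in> borel_measurable M"
    and "integrable M (\<lambda>x. (u x)\<^sup>2)" "integrable M (\<lambda>x. (v x)\<^sup>2)"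
  shows "integrable M (\<lambda>x. u x * v x)"
proof (rule Bochner_Integration.integrable_bound)
  show "integrable M (\<lambda>x. (u x)\<^sup>2 + (v x)\<^sup>2)" using assms by auto
  show "AE x in M. norm (u x * v x) \<le> norm ((u x)\<^sup>2 + (v x)\<^sup>2)"
    using abs_mult_le_sum_squares by simp
qed simp

text \<open>A common test space for both problems. Vanishing off \<open>\<Omega>\<close> is required
  at every point, not just almost everywhere, so that the integrand can be split by pointwise
  identities.\<close>

definition energy_space :: "real \<Rightarrow> 'a::euclidean_space set \<Rightarrow> ('a \<Rightarrow> real) set" where
  "energy_space s \<Omega> = {u \<in> borel_measurable lebesgue. (\<forall>x. x \<notin> \<Omega> \<longrightarrow> u x = 0) \<and>
     integrable lebesgue (\<lambda>x. (u x)\<^sup>2) \<and> integrable leb2 (gagliardo s u u)}"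

lemma integrable_gagliardo:
  assumes "u \<in> energy_space s \<Omega>" "v \<in> energy_space s \<Omega>"
  shows "integrable leb2 (gagliardo s u v)"
proof (rule Bochner_Integration.integrable_bound)
  show "integrable leb2 (\<lambda>p. gagliardo s u u p + gagliardo s v v p)"
    using assms by (auto simp: energy_space_def)
  show "gagliardo s u v \<in> borel_measurable leb2"
    using assms by (auto simp: energy_space_def)
  show "AE p in leb2. norm (gagliardo s u v p) \<le> norm (gagliardo s u u p + gagliardo s v v p)"
    using abs_gagliardo_le[of s u v] by (intro AE_I2) (simp add: order_trans[OF _ abs_ge_self])
qed

lemma energy_space_integrable_mult:
  assumes "u \<in> energy_space s \<Omega>" "v \<in> energy_space s \<Omega>"
  shows "integrable lebesgue (\<lambda>x. u x * v x)"
  using assms by (intro integrable_mult_squares) (auto simp: energy_space_def)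

lemma energy_space_diff:
  assumes u: "u \<in> energy_space s \<Omega>" and v: "v \<in> energy_space s \<Omega>"
  shows "(\<lambda>x. u x - v x) \<in> energy_space s \<Omega>"
proof -
  have "integrable lebesgue (\<lambda>x. (u x)\<^sup>2 - 2 * (u x * v x) + (v x)\<^sup>2)"
    using u v energy_space_integrable_mult[OF u v] by (auto simp: energy_space_def)
  then have "integrable lebesgue (\<lambda>x. (u x - v x)\<^sup>2)"
    by (simp add: power2_diff algebra_simps)
  moreover have "gagliardo s (\<lambda>x. u x - v x) (\<lambda>x. u x - v x) =
      (\<lambda>p. (gagliardo s u u p - gagliardo s u v p) - (gagliardo s u v p - gagliardo s v v p))"
    by (auto simp: gagliardo_diff_left gagliardo_diff_right gagliardo_commute[of s v u] fun_eq_iff)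
  then have "integrable leb2 (gagliardo s (\<lambda>x. u x - v x) (\<lambda>x. u x - v x))"
    using integrable_gagliardo[OF u v] integrable_gagliardo[OF u u] integrable_gagliardo[OF v v]
    by simp
  ultimately show ?thesis using u v by (auto simp: energy_space_def)
qed

section \<open>Near and far parts of the energy\<close>

definition energy :: "real \<Rightarrow> ('a::euclidean_space \<Rightarrow> real) \<Rightarrow> ('a \<Rightarrow> real) \<Rightarrow> real" where
  "energy s u v = (LINT p|leb2. gagliardo s u v p)"

definition near :: "real \<Rightarrow> 'a::euclidean_space \<times> 'a \<Rightarrow> real" where
  "near \<delta> p = indicator {z. norm z < \<delta>} (fst p - snd p)"

lemma measurable_near [measurable]: "near \<delta> \<in> borel_measurable leb2"
  unfolding near_def[abs_def] by measurable

text \<open>Two points of \<open>\<Omega>\<close> are closer than \<open>\<delta>\<close>, so at distance at least \<open>\<delta>\<close> the cross terms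
  \<open>u x * v y\<close> vanish.\<close>

lemma gagliardo_split:
  fixes \<Omega> :: "'a::euclidean_space set"
  assumes u: "\<And>x. x \<notin> \<Omega> \<Longrightarrow> u x = 0" and v: "\<And>x. x \<notin> \<Omega> \<Longrightarrow> v x = 0"
    and diam: "\<And>x y. x \<in> \<Omega> \<Longrightarrow> y \<in> \<Omega> \<Longrightarrow> norm (x - y) < \<delta>"
  shows "gagliardo s u v p = near \<delta> p * gagliardo s u v p
    + (u (fst p) * v (fst p) * kernel_tail s \<delta> (fst p - snd p)
     + u (snd p) * v (snd p) * kernel_tail s \<delta> (fst p - snd p))"
proof (cases "norm (fst p - snd p) < \<delta>")
  case True
  then show ?thesis by (simp add: near_def kernel_tail_def)
next
  case False
  \<comment> \<open>Points at distance at least \<open>\<delta>\<close> cannot both lie in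
    \<open>\<Omega>\<close>, so each mixed product has a vanishing factor.\<close>
  then have "fst p \<notin> \<Omega> \<or> snd p \<notin> \<Omega>" using diam by blast
  then have cross: "u (fst p) * v (snd p) = 0" "u (snd p) * v (fst p) = 0" using u v by auto
  have "(u (fst p) - u (snd p)) * (v (fst p) - v (snd p)) =
      u (fst p) * v (fst p) + u (snd p) * v (snd p)"
    using cross by (simp only: left_diff_distrib right_diff_distrib)
  with False show ?thesis
    by (simp add: near_def kernel_tail_def gagliardo_def add_divide_distrib)
qed

text \<open>The pointwise splitting, integrated: the two far terms, one for each variable,
  contribute the same multiple of the inner product, whence the factor 2.\<close>

lemma energy_split:
  fixes \<Omega> :: "'a::euclidean_space set"
  assumes s: "0 < s" "0 < \<delta>" and u: "u \<in> energy_space s \<Omega>" and v: "v \<in> energy_space s \<Omega>"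
    and diam: "\<And>x y. x \<in> \<Omega> \<Longrightarrow> y \<in> \<Omega> \<Longrightarrow> norm (x - y) < \<delta>"
  shows "energy s u v = (LINT p|leb2. near \<delta> p * gagliardo s u v p)
    + 2 * tail_mass TYPE('a) s \<delta> * (LINT x|lebesgue. u x * v x)"
proof -
  have [measurable]: "u \<in> borel_measurable lebesgue" "v \<in> borel_measurable lebesgue"
    using u v by (auto simp: energy_space_def)
  have u0: "u x = 0" and v0: "v x = 0" if "x \<notin> \<Omega>" for x
    using u v that by (auto simp: energy_space_def)
  have near: "integrable leb2 (\<lambda>p. near \<delta> p * gagliardo s u v p)"
    by (rule Bochner_Integration.integrable_bound[OF integrable_gagliardo[OF u v]])
       (auto simp: near_def indicator_def)
  note split = gagliardo_split[of \<Omega> u v \<delta> s, OF u0 v0 diam]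
  note tail = kernel_tail_product[OF s energy_space_integrable_mult[OF u v]]
  have "energy s u v = (LINT p|leb2. near \<delta> p * gagliardo s u v p
    + (u (fst p) * v (fst p) * kernel_tail s \<delta> (fst p - snd p)
     + u (snd p) * v (snd p) * kernel_tail s \<delta> (fst p - snd p)))"
    unfolding energy_def by (intro Bochner_Integration.integral_cong split refl)
  also have "\<dots> = (LINT p|leb2. near \<delta> p * gagliardo s u v p)
    + 2 * (tail_mass TYPE('a) s \<delta> * (LINT x|lebesgue. u x * v x))"
    using near tail by simp
  finally show ?thesis by simp
qed

text \<open>A Poincare inequality: the near part of the energy of a single function is nonnegative
  and is dropped from the splitting.\<close>

lemma energy_ge_tail_mass:
  fixes \<Omega> :: "'a::euclidean_space set"
  assumes s: "0 < s" "0 < \<delta>" and u: "u \<in> energy_space s \<Omega>"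
    and diam: "\<And>x y. x \<in> \<Omega> \<Longrightarrow> y \<in> \<Omega> \<Longrightarrow> norm (x - y) < \<delta>"
  shows "2 * tail_mass TYPE('a) s \<delta> * (LINT x|lebesgue. (u x)\<^sup>2) \<le> energy s u u"
proof -
  have "0 \<le> (LINT p|leb2. near \<delta> p * gagliardo s u u p)"
    by (intro integral_nonneg_AE AE_I2) (simp add: near_def)
  then show ?thesis using energy_split[OF s u u diam] by (simp add: power2_eq_square)
qed

subsection \<open>Extension by zero\<close>

lemma c_const_pos:
  assumes "0 < s" "s < 1"
  shows "0 < c_const N s"
  unfolding c_const_def using assms
  by (intro divide_pos_pos mult_pos_pos Gamma_real_pos add_nonneg_pos) auto

text \<open>As a union of balls the extended domain is open, hence measurable.\<close>

lemma extended_domain_eq: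
  assumes "0 < \<delta>"
  shows "extended_domain \<delta> \<Omega> = (\<Union>x\<in>\<Omega>. ball x \<delta>)"
  using assms by (force simp: extended_domain_def nonlocal_boundary_def dist_norm)

lemma sets_extended_domain:
  fixes \<Omega> :: "'a::euclidean_space set"
  assumes "0 < \<delta>"
  shows "extended_domain \<delta> \<Omega> \<in> sets lebesgue"
proof -
  have "open (extended_domain \<delta> \<Omega>)" unfolding extended_domain_eq[OF assms] by blast
  then show ?thesis by simp
qed

section \<open>Representatives up to null sets, and the two solution spaces\<close>

lemma indicator_power2: "(indicator A x :: real)\<^sup>2 = indicator A x"
  by (simp split: split_indicator)

lemma L2_iff:
  assumes "A \<in> sets lebesgue"
  shows "v \<in> L2 A \<longleftrightarrow> (\<lambda>x. indicator A x * v x) \<in> borel_measurable lebesgue \<and>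
    integrable lebesgue (\<lambda>x. (indicator A x * v x)\<^sup>2)"
  using assms
  by (simp add: L2_def borel_measurable_restrict_space_iff integrable_restrict_space
      power_mult_distrib indicator_power2)

lemma L2_norm_eq:
  assumes "A \<in> sets lebesgue"
  shows "L2_norm A v = sqrt (LINT x|lebesgue. (indicator A x * v x)\<^sup>2)"
  using assms
  by (simp add: L2_norm_def integral_restrict_space power_mult_distrib indicator_power2)

text \<open>The integrand is an arbitrary \<open>F\<close>, so that one statement serves both the
  energy over the whole space and the energy weighted by indicators of the extended domain.\<close>

lemma nn_integral_double_cong_AE:
  fixes F :: "real \<Rightarrow> real \<Rightarrow> 'a::euclidean_space \<Rightarrow> 'a \<Rightarrow> ennreal"
  assumes ae: "AE x in lebesgue. u x = v x"
  shows "(\<integral>\<^sup>+x. \<integral>\<^sup>+y. F (u x) (u y) x y \<partial>lebesgue \<partial>lebesgue)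
       = (\<integral>\<^sup>+x. \<integral>\<^sup>+y. F (v x) (v y) x y \<partial>lebesgue \<partial>lebesgue)"
proof (rule nn_integral_cong_AE)
  show "AE x in lebesgue. (\<integral>\<^sup>+y. F (u x) (u y) x y \<partial>lebesgue) = (\<integral>\<^sup>+y. F (v x) (v y) x y \<partial>lebesgue)"
    using ae
  proof eventually_elim
    case (elim x)
    show ?case using ae by (intro nn_integral_cong_AE, eventually_elim) (simp add: elim)
  qed
qed

lemma nn_integral_gagliardo:
  assumes [measurable]: "u \<in> borel_measurable lebesgue" "h \<in> borel_measurable leb2"
  shows "(\<integral>\<^sup>+x. \<integral>\<^sup>+y. ennreal (h (x, y) * gagliardo s u u (x, y)) \<partial>lebesgue \<partial>lebesgue)
    = (\<integral>\<^sup>+p. ennreal (h p * gagliardo s u u p) \<partial>leb2)"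
  by (rule leb.nn_integral_fst[of "\<lambda>p. ennreal (h p * gagliardo s u u p)"]) measurable

lemma gagliardo_quotient:
  fixes u :: "'a::euclidean_space \<Rightarrow> real"
  shows "(u x - u y)\<^sup>2 / norm (x - y) powr (real DIM('a) + 2 * s) = gagliardo s u u (x, y)"
  by (simp add: gagliardo_def power2_eq_square)

lemma integral_double_cong_AE:
  fixes u v w :: "'a::euclidean_space \<Rightarrow> real" and h :: "'a \<times> 'a \<Rightarrow> real"
  assumes ae: "AE x in lebesgue. u x = v x"
    and [measurable]: "u \<in> borel_measurable lebesgue" "v \<in> borel_measurable lebesgue"
      "w \<in> borel_measurable lebesgue" "h \<in> borel_measurable leb2"
  shows "(LINT x|lebesgue. LINT y|lebesgue. h (x, y) * gagliardo s u w (x, y))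
       = (LINT x|lebesgue. LINT y|lebesgue. h (x, y) * gagliardo s v w (x, y))"
proof (rule integral_cong_AE)
  have [measurable]: "(\<lambda>p. h p * gagliardo s u w p) \<in> borel_measurable leb2"
    "(\<lambda>p. h p * gagliardo s v w p) \<in> borel_measurable leb2"
    by measurable
  show "(\<lambda>x. LINT y|lebesgue. h (x, y) * gagliardo s u w (x, y)) \<in> borel_measurable lebesgue"
    "(\<lambda>x. LINT y|lebesgue. h (x, y) * gagliardo s v w (x, y)) \<in> borel_measurable lebesgue"
    by measurable
  show "AE x in lebesgue. (LINT y|lebesgue. h (x, y) * gagliardo s u w (x, y))
      = (LINT y|lebesgue. h (x, y) * gagliardo s v w (x, y))"
    using ae
  proof eventually_elim
    case (elim x)
    show ?case
    proof (rule integral_cong_AE)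
      show "AE y in lebesgue. h (x, y) * gagliardo s u w (x, y) = h (x, y) * gagliardo s v w (x, y)"
        using ae by eventually_elim (simp add: gagliardo_def elim)
    qed measurable
  qed
qed

text \<open>Multiplying by the indicator of \<open>\<Omega>\<close> selects a representative that
  vanishes everywhere off \<open>\<Omega>\<close>; only a null set is affected, so the energy is
  unchanged, and Tonelli moves it to the product measure.\<close>

lemma H0_imp_energy_space:
  fixes \<Omega> :: "'a::euclidean_space set"
  assumes \<Omega>: "open \<Omega>" and v: "v \<in> H0 s \<Omega>"
  shows "(\<lambda>x. indicator \<Omega> x * v x) \<in> energy_space s \<Omega>"
    and "AE x in lebesgue. v x = indicator \<Omega> x * v x"
    and "v \<in> borel_measurable lebesgue"
proof -
  let ?v = "\<lambda>x. indicator \<Omega> x * v x"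
  have "v \<in> L2 UNIV" using v by (simp add: H0_def Hs_def)
  then have meas [measurable]: "v \<in> borel_measurable lebesgue"
    and sq: "integrable lebesgue (\<lambda>x. (v x)\<^sup>2)"
    by (simp_all add: L2_iff)
  have [measurable]: "\<Omega> \<in> sets lebesgue" using \<Omega> by simp
  have meas': "?v \<in> borel_measurable lebesgue" by measurable
  show ae: "AE x in lebesgue. v x = ?v x"
    using v by (auto simp: H0_def elim!: eventually_mono split: split_indicator)
  have sq': "integrable lebesgue (\<lambda>x. (?v x)\<^sup>2)"
    by (rule integrable_cong_AE_imp[OF sq]) (use ae in \<open>auto elim!: eventually_mono\<close>)
  have "(\<integral>\<^sup>+x. \<integral>\<^sup>+y. ennreal (gagliardo s v v (x, y)) \<partial>lebesgue \<partial>lebesgue) < \<infinity>"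
    using v by (simp add: H0_def Hs_def gagliardo_quotient)
  also have "(\<integral>\<^sup>+x. \<integral>\<^sup>+y. ennreal (gagliardo s v v (x, y)) \<partial>lebesgue \<partial>lebesgue)
      = (\<integral>\<^sup>+x. \<integral>\<^sup>+y. ennreal (gagliardo s ?v ?v (x, y)) \<partial>lebesgue \<partial>lebesgue)"
    using nn_integral_double_cong_AE[OF ae, of "\<lambda>a b x y. ennreal ((a - b) * (a - b) /
      norm (x - y) powr (real DIM('a) + 2 * s))"]
    by (simp add: gagliardo_def)
  also have "\<dots> = (\<integral>\<^sup>+p. ennreal (gagliardo s ?v ?v p) \<partial>leb2)"
    using nn_integral_gagliardo[OF meas', of "\<lambda>_. 1"] by simp
  finally have "integrable leb2 (gagliardo s ?v ?v)"
    using meas' by (intro integrableI_nonneg) auto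
  with meas' sq' show "?v \<in> energy_space s \<Omega>" by (simp add: energy_space_def)
  show "v \<in> borel_measurable lebesgue" by (rule meas)
qed

lemma energy_space_imp_H0:
  assumes v: "v \<in> energy_space s \<Omega>"
  shows "v \<in> H0 s \<Omega>"
proof -
  have [measurable]: "v \<in> borel_measurable lebesgue"
    and sq: "integrable lebesgue (\<lambda>x. (v x)\<^sup>2)" and g: "integrable leb2 (gagliardo s v v)"
    and z: "\<And>x. x \<notin> \<Omega> \<Longrightarrow> v x = 0"
    using v by (auto simp: energy_space_def)
  have "(\<integral>\<^sup>+p. ennreal (gagliardo s v v p) \<partial>leb2) < \<infinity>"
    using g by (simp add: integrable_iff_bounded)
  then have "(\<integral>\<^sup>+x. \<integral>\<^sup>+y. ennreal (gagliardo s v v (x, y)) \<partial>lebesgue \<partial>lebesgue) < \<infinity>"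
    using nn_integral_gagliardo[of v "\<lambda>_. 1"] by simp
  with sq z show ?thesis by (simp add: H0_def Hs_def L2_iff gagliardo_quotient)
qed

text \<open>If \<open>w x\<close> and \<open>w y\<close> differ, one of the points lies in
  \<open>\<Omega>\<close>; if moreover they are closer than \<open>\<delta>\<close>, both lie in the
  extended domain. In all other cases both sides vanish. Hence restricting to the extended domain
  amounts to \<open>near\<close> alone.\<close>

lemma near_restrict:
  assumes d: "0 < \<delta>" and z: "\<And>x. x \<notin> \<Omega> \<Longrightarrow> w x = 0"
  shows "indicator (extended_domain \<delta> \<Omega>) x * indicator (extended_domain \<delta> \<Omega> \<inter> ball x \<delta>) y * (w x - w y)
    = near \<delta> (x, y) * (w x - w y)"
proof (cases "norm (x - y) < \<delta> \<and> w x \<noteq> w y")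
  case True
  then have "x \<in> \<Omega> \<or> y \<in> \<Omega>" using z by metis
  moreover have "dist x y < \<delta>" "dist y x < \<delta>" using True by (auto simp: dist_norm norm_minus_commute)
  ultimately have "x \<in> extended_domain \<delta> \<Omega>" "y \<in> extended_domain \<delta> \<Omega>"
    using d unfolding extended_domain_eq[OF d] by (auto simp: dist_commute intro: bexI[of _ x] bexI[of _ y])
  then show ?thesis using True by (simp add: near_def dist_norm)
next
  case False
  then show ?thesis by (auto simp: near_def dist_norm split: split_indicator)
qed

text \<open>Finite truncated energy already gives finite full energy: what the truncation omits is
  controlled by the square integral times the integrable tail of the kernel.\<close>

lemma H0_delta_imp_energy_space:
  fixes \<Omega> :: "'a::euclidean_space set"
  assumes s: "0 < s" and d: "0 < \<delta>" and \<Omega>: "open \<Omega>" and v: "v \<in> H0_delta \<delta> s \<Omega>"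
  shows "(\<lambda>x. indicator \<Omega> x * v x) \<in> energy_space s \<Omega>"
    and "AE x in lebesgue. indicator (extended_domain \<delta> \<Omega>) x * v x = indicator \<Omega> x * v x"
    and "(\<lambda>x. indicator (extended_domain \<delta> \<Omega>) x * v x) \<in> borel_measurable lebesgue"
proof -
  let ?S = "extended_domain \<delta> \<Omega>"
  let ?w = "\<lambda>x. indicator ?S x * v x"
  let ?v = "\<lambda>x. indicator \<Omega> x * v x"
  have S: "?S \<in> sets lebesgue" by (rule sets_extended_domain[OF d])
  have sub: "\<Omega> \<subseteq> ?S" by (auto simp: extended_domain_def)
  have "v \<in> L2 ?S" using v by (simp add: H0_delta_def)
  then have meas: "?w \<in> borel_measurable lebesgue" and sq: "integrable lebesgue (\<lambda>x. (?w x)\<^sup>2)"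
    by (simp_all add: L2_iff S)
  show "?w \<in> borel_measurable lebesgue" by (rule meas)
  have [measurable]: "\<Omega> \<in> sets lebesgue" using \<Omega> by simp
  \<comment> \<open>Measurability is known for \<open>v\<close> only on the extended domain, so it
    is passed on through \<open>?w\<close>.\<close>
  have vw: "?v = (\<lambda>x. indicator \<Omega> x * ?w x)" using sub by (auto simp: fun_eq_iff split: split_indicator)
  have meas' [measurable]: "?v \<in> borel_measurable lebesgue"
    unfolding vw by (rule borel_measurable_times[OF _ meas]) simp
  have "AE x in lebesgue. x \<in> nonlocal_boundary \<delta> \<Omega> \<longrightarrow> v x = 0"
    using v by (simp add: H0_delta_def)
  then show ae: "AE x in lebesgue. ?w x = ?v x"
    by eventually_elim (use sub in \<open>auto simp: extended_domain_def split: split_indicator\<close>)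
  have sq': "integrable lebesgue (\<lambda>x. (?v x)\<^sup>2)"
    by (rule integrable_cong_AE_imp[OF sq]) (use ae in \<open>auto elim!: eventually_mono\<close>)
  let ?K = "\<lambda>x y. norm (x - y) powr (real DIM('a) + 2 * s)"
  let ?I = "\<lambda>x y. indicator ?S x * indicator (?S \<inter> ball x \<delta>) y :: real"
  have "(\<integral>\<^sup>+x. \<integral>\<^sup>+y. ennreal (?I x y * (\<bar>?w x - ?w y\<bar>\<^sup>2 / ?K x y)) \<partial>lebesgue \<partial>lebesgue)
      = (\<integral>\<^sup>+x\<in>?S. (\<integral>\<^sup>+y\<in>?S \<inter> ball x \<delta>. ennreal (\<bar>v x - v y\<bar>\<^sup>2 / ?K x y) \<partial>lebesgue) \<partial>lebesgue)"
    by (intro nn_integral_cong) (auto split: split_indicator intro!: nn_integral_cong)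
  also have "\<dots> < \<infinity>" using v by (simp add: H0_delta_def)
  finally have "(\<integral>\<^sup>+x. \<integral>\<^sup>+y. ennreal (?I x y * (\<bar>?w x - ?w y\<bar>\<^sup>2 / ?K x y)) \<partial>lebesgue \<partial>lebesgue) < \<infinity>" .
  also have "(\<integral>\<^sup>+x. \<integral>\<^sup>+y. ennreal (?I x y * (\<bar>?w x - ?w y\<bar>\<^sup>2 / ?K x y)) \<partial>lebesgue \<partial>lebesgue)
      = (\<integral>\<^sup>+x. \<integral>\<^sup>+y. ennreal (?I x y * (\<bar>?v x - ?v y\<bar>\<^sup>2 / ?K x y)) \<partial>lebesgue \<partial>lebesgue)"
    by (rule nn_integral_double_cong_AE[OF ae,
        of "\<lambda>a b x y. ennreal (?I x y * (\<bar>a - b\<bar>\<^sup>2 / ?K x y))"])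
  also have "\<dots> = (\<integral>\<^sup>+x. \<integral>\<^sup>+y. ennreal (near \<delta> (x, y) * gagliardo s ?v ?v (x, y)) \<partial>lebesgue \<partial>lebesgue)"
  proof (intro nn_integral_cong arg_cong[where f = ennreal])
    fix x y :: 'a
    \<comment> \<open>The restriction is traded for \<open>near\<close> on one factor of the square;
      the other factor, divided by the kernel power, is then multiplied on.\<close>
    have "?I x y * (?v x - ?v y) = near \<delta> (x, y) * (?v x - ?v y)"
      by (rule near_restrict[OF d]) simp
    then have "?I x y * (?v x - ?v y) * ((?v x - ?v y) / ?K x y)
        = near \<delta> (x, y) * (?v x - ?v y) * ((?v x - ?v y) / ?K x y)"
      by (rule arg_cong)
    then show "?I x y * (\<bar>?v x - ?v y\<bar>\<^sup>2 / ?K x y) = near \<delta> (x, y) * gagliardo s ?v ?v (x, y)"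
      by (simp only: gagliardo_def fst_conv snd_conv power2_abs power2_eq_square mult.assoc
          times_divide_eq_right)
  qed
  also have "\<dots> = (\<integral>\<^sup>+p. ennreal (near \<delta> p * gagliardo s ?v ?v p) \<partial>leb2)"
    by (rule nn_integral_gagliardo[OF meas' measurable_near])
  finally have near: "integrable leb2 (\<lambda>p. near \<delta> p * gagliardo s ?v ?v p)"
    by (intro integrableI_nonneg) (auto simp: near_def)
  let ?T = "\<lambda>p. kernel_tail s \<delta> (fst p - snd p)"
  have dom: "integrable leb2 (\<lambda>p. near \<delta> p * gagliardo s ?v ?v p
      + (2 * ((?v (fst p))\<^sup>2 * ?T p) + 2 * ((?v (snd p))\<^sup>2 * ?T p)))"
    using near integrable_kernel_tail_fst[OF s d sq'] integrable_kernel_tail_snd[OF s d sq']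
    by (intro Bochner_Integration.integrable_add integrable_mult_right) auto
  have le: "gagliardo s ?v ?v p \<le> near \<delta> p * gagliardo s ?v ?v p
      + (2 * ((?v (fst p))\<^sup>2 * ?T p) + 2 * ((?v (snd p))\<^sup>2 * ?T p))" for p
  proof (cases "norm (fst p - snd p) < \<delta>")
    case True
    then show ?thesis by (simp add: near_def kernel_tail_def)
  next
    case False
    \<comment> \<open>Here \<open>\<delta>\<close> may be smaller than the diameter of
      \<open>\<Omega>\<close>, so the cross terms can survive; they are absorbed by (a - b)^2 \<le>
      2 a^2 + 2 b^2.\<close>
    have sq_le: "(a - b) * (a - b) / k \<le> 2 * (a\<^sup>2 * (1 / k)) + 2 * (b\<^sup>2 * (1 / k))"
      if "0 \<le> k" for a b k :: real
    proof -
      have "(a - b) * (a - b) \<le> 2 * a\<^sup>2 + 2 * b\<^sup>2"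
        using sum_squares_bound[of "a" "- b"] by (simp add: power2_eq_square algebra_simps)
      then show ?thesis using divide_right_mono[OF _ that] by (simp flip: add_divide_distrib)
    qed
    show ?thesis
      using False sq_le[of "?K (fst p) (snd p)" "?v (fst p)" "?v (snd p)"]
      by (simp add: near_def kernel_tail_def gagliardo_def)
  qed
  have "integrable leb2 (gagliardo s ?v ?v)"
  proof (rule Bochner_Integration.integrable_bound[OF dom])
    show "AE p in leb2. norm (gagliardo s ?v ?v p) \<le> norm (near \<delta> p * gagliardo s ?v ?v p
      + (2 * ((?v (fst p))\<^sup>2 * ?T p) + 2 * ((?v (snd p))\<^sup>2 * ?T p)))"
      by (intro AE_I2) (simp only: real_norm_def abs_of_nonneg[OF gagliardo_self_nonneg]
          order_trans[OF le abs_ge_self])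
  qed simp
  with meas' sq' show "?v \<in> energy_space s \<Omega>" by (simp add: energy_space_def)
qed

text \<open>Enlarging both domains of integration to the whole space bounds the truncated energy by
  the full one. This makes elements of \<open>energy_space\<close> admissible tests for every
  positive \<open>\<delta>\<close>.\<close>

lemma energy_space_imp_H0_delta:
  fixes \<Omega> :: "'a::euclidean_space set"
  assumes d: "0 < \<delta>" and v: "v \<in> energy_space s \<Omega>"
  shows "v \<in> H0_delta \<delta> s \<Omega>"
proof -
  let ?S = "extended_domain \<delta> \<Omega>"
  let ?q = "\<lambda>x y. ennreal (\<bar>v x - v y\<bar>\<^sup>2 / norm (x - y) powr (real DIM('a) + 2 * s))"
  have z: "\<And>x. x \<notin> \<Omega> \<Longrightarrow> v x = 0" using v by (auto simp: energy_space_def)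
  then have eq: "indicator ?S x * v x = v x" for x
    by (auto simp: extended_domain_def split: split_indicator)
  then have "v \<in> L2 ?S"
    unfolding L2_iff[OF sets_extended_domain[OF d]] eq using v by (simp add: energy_space_def)
  moreover have "(\<integral>\<^sup>+x\<in>?S. (\<integral>\<^sup>+y\<in>?S \<inter> ball x \<delta>. ?q x y \<partial>lebesgue) \<partial>lebesgue)
      \<le> (\<integral>\<^sup>+x. \<integral>\<^sup>+y. ?q x y \<partial>lebesgue \<partial>lebesgue)"
    by (intro nn_integral_mono) (auto split: split_indicator intro!: nn_integral_mono)
  moreover have "\<dots> < \<infinity>"
    using energy_space_imp_H0[OF v] by (simp add: H0_def Hs_def)
  ultimately show ?thesis
    using z by (auto simp: H0_delta_def nonlocal_boundary_def intro: order_le_less_trans)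
qed

section \<open>The two weak forms as integrals over the product measure\<close>

lemma form_infinity_eq_energy:
  fixes \<Omega> :: "'a::euclidean_space set"
  assumes \<Omega>: "open \<Omega>" and u: "u \<in> H0 s \<Omega>" and w: "w \<in> energy_space s \<Omega>"
  shows "(LINT x|lebesgue. LINT y|lebesgue.
      (u x - u y) * (w x - w y) / norm (x - y) powr (real DIM('a) + 2 * s))
    = energy s (\<lambda>x. indicator \<Omega> x * u x) w"
proof -
  note U = H0_imp_energy_space[OF \<Omega> u]
  have m: "(\<lambda>x. indicator \<Omega> x * u x) \<in> borel_measurable lebesgue" "w \<in> borel_measurable lebesgue"
    using U(1) w by (auto simp: energy_space_def)
  have "(LINT x|lebesgue. LINT y|lebesgue.
      (u x - u y) * (w x - w y) / norm (x - y) powr (real DIM('a) + 2 * s))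
    = (LINT x|lebesgue. LINT y|lebesgue. gagliardo s u w (x, y))"
    by (simp add: gagliardo_def)
  also have "\<dots> = (LINT x|lebesgue. LINT y|lebesgue. gagliardo s (\<lambda>x. indicator \<Omega> x * u x) w (x, y))"
    using integral_double_cong_AE[OF U(2,3) m, of "\<lambda>_. 1" s] by simp
  also have "\<dots> = energy s (\<lambda>x. indicator \<Omega> x * u x) w"
    unfolding energy_def by (rule leb_pair.integral_fst'[OF integrable_gagliardo[OF U(1) w]])
  finally show ?thesis .
qed

lemma form_delta_eq:
  fixes \<Omega> :: "'a::euclidean_space set"
  assumes s: "0 < s" and d: "0 < \<delta>" and \<Omega>: "open \<Omega>"
    and u: "u \<in> H0_delta \<delta> s \<Omega>" and w: "w \<in> energy_space s \<Omega>"
  shows "(LINT x:extended_domain \<delta> \<Omega>|lebesgue. (LINT y:extended_domain \<delta> \<Omega> \<inter> ball x \<delta>|lebesgue.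
      (u x - u y) * (w x - w y) / norm (x - y) powr (real DIM('a) + 2 * s)))
    = (LINT p|leb2. near \<delta> p * gagliardo s (\<lambda>x. indicator \<Omega> x * u x) w p)"
proof -
  let ?S = "extended_domain \<delta> \<Omega>"
  let ?u = "\<lambda>x. indicator ?S x * u x"
  let ?U = "\<lambda>x. indicator \<Omega> x * u x"
  let ?K = "\<lambda>x y. norm (x - y) powr (real DIM('a) + 2 * s)"
  let ?I = "\<lambda>x y. indicator ?S x * indicator (?S \<inter> ball x \<delta>) y :: real"
  note U = H0_delta_imp_energy_space[OF s d \<Omega> u]
  have m: "?U \<in> borel_measurable lebesgue" "w \<in> borel_measurable lebesgue"
    using U(1) w by (auto simp: energy_space_def)
  have "(LINT x:?S|lebesgue. (LINT y:?S \<inter> ball x \<delta>|lebesgue. (u x - u y) * (w x - w y) / ?K x y))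
      = (LINT x|lebesgue. LINT y|lebesgue. ?I x y * ((u x - u y) * (w x - w y) / ?K x y))"
    by (simp add: set_lebesgue_integral_def mult.assoc del: times_divide_eq_right)
  also have "\<dots> = (LINT x|lebesgue. LINT y|lebesgue. near \<delta> (x, y) * gagliardo s ?u w (x, y))"
  proof (intro Bochner_Integration.integral_cong refl)
    fix x y :: 'a
    \<comment> \<open>The test function alone absorbs the restriction, since \<open>u\<close> is not
      controlled outside the extended domain.\<close>
    have "?I x y * (w x - w y) = near \<delta> (x, y) * (w x - w y)"
      using w by (intro near_restrict[OF d]) (auto simp: energy_space_def)
    then have "?I x y * (w x - w y) * ((?u x - ?u y) / ?K x y)
        = near \<delta> (x, y) * (w x - w y) * ((?u x - ?u y) / ?K x y)"
      by (rule arg_cong)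
    \<comment> \<open>\<open>u\<close> and \<open>?u\<close> agree on the extended domain, and
      \<open>?I\<close> vanishes as soon as one of the points is outside it.\<close>
    moreover have "?I x y * (w x - w y) * ((?u x - ?u y) / ?K x y)
        = ?I x y * (w x - w y) * ((u x - u y) / ?K x y)"
      by (auto split: split_indicator)
    ultimately show "?I x y * ((u x - u y) * (w x - w y) / ?K x y)
        = near \<delta> (x, y) * gagliardo s ?u w (x, y)"
      by (simp only: gagliardo_def fst_conv snd_conv divide_inverse mult_ac)
  qed
  also have "\<dots> = (LINT x|lebesgue. LINT y|lebesgue. near \<delta> (x, y) * gagliardo s ?U w (x, y))"
    by (rule integral_double_cong_AE[OF U(2,3) m measurable_near])
  also have "\<dots> = (LINT p|leb2. near \<delta> p * gagliardo s ?U w p)"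
  proof (rule leb_pair.integral_fst')
    show "integrable leb2 (\<lambda>p. near \<delta> p * gagliardo s ?U w p)"
      using m by (intro Bochner_Integration.integrable_bound[OF integrable_gagliardo[OF U(1) w]])
         (auto simp: near_def indicator_def)
  qed
  finally show ?thesis .
qed

subsection \<open>Comparison of the two weak solutions\<close>

lemma energy_diff_left:
  assumes "u \<in> energy_space s \<Omega>" "v \<in> energy_space s \<Omega>" "w \<in> energy_space s \<Omega>"
  shows "energy s (\<lambda>x. u x - v x) w = energy s u w - energy s v w"
  using integrable_gagliardo[OF assms(1,3)] integrable_gagliardo[OF assms(2,3)]
  by (simp add: energy_def gagliardo_diff_left)

text \<open>Two radii are at work: the fixed \<open>D\<close> supplies the Poincare constant, while
  \<open>\<delta>\<close> measures the error made by truncating. The bound is informative once the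
  bracket on the left is positive.\<close>

lemma weak_solution_error_bound:
  fixes \<Omega> :: "'a::euclidean_space set"
  assumes s: "0 < s" "s < 1" and \<Omega>: "open \<Omega>" and D: "0 < D" "D \<le> \<delta>"
    and diam: "\<And>x y. x \<in> \<Omega> \<Longrightarrow> y \<in> \<Omega> \<Longrightarrow> norm (x - y) < D"
    and u: "weak_solution_delta \<delta> s \<Omega> f u" and v: "weak_solution_infinity s \<Omega> f v"
  shows "(2 * tail_mass TYPE('a) s D - 3 * tail_mass TYPE('a) s \<delta>) * (L2_norm \<Omega> (\<lambda>x. u x - v x))\<^sup>2
    \<le> tail_mass TYPE('a) s \<delta> * (L2_norm \<Omega> v)\<^sup>2"
proof -
  let ?C = "tail_mass TYPE('a) s"
  define U where "U = (\<lambda>x. indicator \<Omega> x * u x)"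
  define V where "V = (\<lambda>x. indicator \<Omega> x * v x)"
  define W where "W = (\<lambda>x. U x - V x)"
  have d: "0 < \<delta>" using D by simp
  have diam': "norm (x - y) < \<delta>" if "x \<in> \<Omega>" "y \<in> \<Omega>" for x y
    using diam[OF that] D by simp
  have uH: "u \<in> H0_delta \<delta> s \<Omega>" and vH: "v \<in> H0 s \<Omega>"
    using u v by (auto simp: weak_solution_delta_def weak_solution_infinity_def)
  have U: "U \<in> energy_space s \<Omega>" unfolding U_def
    by (rule H0_delta_imp_energy_space(1)[OF s(1) d \<Omega> uH])
  have V: "V \<in> energy_space s \<Omega>" unfolding V_def
    by (rule H0_imp_energy_space(1)[OF \<Omega> vH])
  have W: "W \<in> energy_space s \<Omega>" unfolding W_def by (rule energy_space_diff[OF U V])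
  have eq\<delta>: "c_const DIM('a) s / 2 * (LINT p|leb2. near \<delta> p * gagliardo s U W p)
      = (LINT x:\<Omega>|lebesgue. f x * W x)"
    using bspec[OF conjunct2[OF u[unfolded weak_solution_delta_def]] energy_space_imp_H0_delta[OF d W]]
    unfolding form_delta_eq[OF s(1) d \<Omega> uH W] U_def .
  have eqinf: "c_const DIM('a) s / 2 * energy s V W = (LINT x:\<Omega>|lebesgue. f x * W x)"
    using bspec[OF conjunct2[OF v[unfolded weak_solution_infinity_def]] energy_space_imp_H0[OF W]]
    unfolding form_infinity_eq_energy[OF \<Omega> vH W] V_def .
  \<comment> \<open>Both forms, tested with \<open>W\<close>, equal the same load term, and the
    positive constant in front cancels.\<close>
  have "(LINT p|leb2. near \<delta> p * gagliardo s U W p) = energy s V W"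
    using eq\<delta>[folded eqinf] c_const_pos[OF s, of "DIM('a)"] by simp
  \<comment> \<open>The energy of \<open>W\<close> is that of \<open>U\<close> against
    \<open>W\<close> minus that of \<open>V\<close> against \<open>W\<close>. The near part of the
    former cancels the latter, and only the far part remains.\<close>
  then have "energy s W W = 2 * ?C \<delta> * (LINT x|lebesgue. U x * W x)"
    using energy_split[OF s(1) d U W diam'] energy_diff_left[OF U V W] by (simp add: W_def)
  then have le: "2 * ?C D * (LINT x|lebesgue. (W x)\<^sup>2) \<le> 2 * ?C \<delta> * (LINT x|lebesgue. U x * W x)"
    using energy_ge_tail_mass[OF s(1) D(1) W diam] by simp
  have sq: "integrable lebesgue (\<lambda>x. (V x)\<^sup>2)" "integrable lebesgue (\<lambda>x. (W x)\<^sup>2)"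
    using V W by (auto simp: energy_space_def)
  \<comment> \<open>Since \<open>U\<close> = \<open>W\<close> + \<open>V\<close>, the product is W^2
    + V W, and V W is at most half the sum of the squares. Multiplied by twice the tail mass at
    \<open>\<delta>\<close>, the 3/2 becomes the 3 in the claim.\<close>
  have "(LINT x|lebesgue. U x * W x) \<le> (LINT x|lebesgue. 3 / 2 * (W x)\<^sup>2 + 1 / 2 * (V x)\<^sup>2)"
  proof (rule integral_mono)
    show "integrable lebesgue (\<lambda>x. U x * W x)" by (rule energy_space_integrable_mult[OF U W])
    show "integrable lebesgue (\<lambda>x. 3 / 2 * (W x)\<^sup>2 + 1 / 2 * (V x)\<^sup>2)" using sq by auto
    show "U x * W x \<le> 3 / 2 * (W x)\<^sup>2 + 1 / 2 * (V x)\<^sup>2" for x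
      using sum_squares_bound[of "V x" "W x"]
      by (simp add: W_def power2_eq_square algebra_simps)
  qed
  also have "\<dots> = 3 / 2 * (LINT x|lebesgue. (W x)\<^sup>2) + 1 / 2 * (LINT x|lebesgue. (V x)\<^sup>2)"
    using sq by simp
  finally have "2 * ?C \<delta> * (LINT x|lebesgue. U x * W x)
      \<le> 2 * ?C \<delta> * (3 / 2 * (LINT x|lebesgue. (W x)\<^sup>2) + 1 / 2 * (LINT x|lebesgue. (V x)\<^sup>2))"
    using tail_mass_nonneg by (intro mult_left_mono) auto
  with le have "(2 * ?C D - 3 * ?C \<delta>) * (LINT x|lebesgue. (W x)\<^sup>2)
      \<le> ?C \<delta> * (LINT x|lebesgue. (V x)\<^sup>2)"
    by (simp add: algebra_simps)
  moreover have "(L2_norm \<Omega> (\<lambda>x. u x - v x))\<^sup>2 = (LINT x|lebesgue. (W x)\<^sup>2)"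
    "(L2_norm \<Omega> v)\<^sup>2 = (LINT x|lebesgue. (V x)\<^sup>2)"
    using \<Omega> by (simp_all add: L2_norm_eq W_def U_def V_def right_diff_distrib)
  ultimately show ?thesis by simp
qed

lemma weak_solution_tendsto:
  fixes \<Omega> :: "'a::euclidean_space set"
  assumes s: "0 < s" "s < 1" and \<Omega>: "open \<Omega>" "bounded \<Omega>"
    and u: "\<And>\<delta>. 0 < \<delta> \<Longrightarrow> weak_solution_delta \<delta> s \<Omega> f (u \<delta>)"
    and v: "weak_solution_infinity s \<Omega> f v"
  shows "((\<lambda>\<delta>. L2_norm \<Omega> (\<lambda>x. u \<delta> x - v x)) \<longlongrightarrow> 0) at_top"
proof -
  let ?C = "tail_mass TYPE('a) s"
  define e where "e \<delta> = L2_norm \<Omega> (\<lambda>x. u \<delta> x - v x)" for \<delta>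
  obtain B where B: "0 < B" "\<And>x. x \<in> \<Omega> \<Longrightarrow> norm x \<le> B"
    using \<Omega>(2) by (auto simp: bounded_pos)
  \<comment> \<open>The distance within \<open>\<Omega>\<close> is at most 2 \<open>B\<close>; the
    extra 1 makes the bound strict.\<close>
  define D where "D = 2 * B + 1"
  have D: "0 < D" using B by (simp add: D_def)
  have diam: "norm (x - y) < D" if "x \<in> \<Omega>" "y \<in> \<Omega>" for x y
    using norm_triangle_ineq4[of x y] B(2)[OF that(1)] B(2)[OF that(2)] by (simp add: D_def)
  have pos: "0 < ?C D" by (rule tail_mass_pos[OF s(1) D])
  define g where "g \<delta> = ?C \<delta> * (L2_norm \<Omega> v)\<^sup>2 / (2 * ?C D - 3 * ?C \<delta>)" for \<delta>
  have lim: "(?C \<longlongrightarrow> 0) at_top" by (rule tail_mass_tendsto_0[OF s(1)])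
  have "((\<lambda>\<delta>. 2 * ?C D - 3 * ?C \<delta>) \<longlongrightarrow> 2 * ?C D - 3 * 0) at_top"
    by (intro tendsto_intros lim)
  then have den: "((\<lambda>\<delta>. 2 * ?C D - 3 * ?C \<delta>) \<longlongrightarrow> 2 * ?C D) at_top" by simp
  have "(g \<longlongrightarrow> 0 * (L2_norm \<Omega> v)\<^sup>2 / (2 * ?C D)) at_top"
    unfolding g_def by (intro tendsto_intros lim den) (use pos in simp)
  then have g: "(g \<longlongrightarrow> 0) at_top" by simp
  \<comment> \<open>The denominator of \<open>g\<close> tends to twice the tail mass at
    \<open>D\<close>, which is positive, so dividing the error bound by it is eventually
    legitimate.\<close>
  have "\<forall>\<^sub>F \<delta> in at_top. 0 < 2 * ?C D - 3 * ?C \<delta>"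
    using order_tendstoD(1)[OF den, of 0] pos by simp
  then have "\<forall>\<^sub>F \<delta> in at_top. (e \<delta>)\<^sup>2 \<le> g \<delta>"
    using eventually_ge_at_top[of D]
  proof eventually_elim
    case (elim \<delta>)
    then have "weak_solution_delta \<delta> s \<Omega> f (u \<delta>)" using u D by simp
    from weak_solution_error_bound[OF s \<Omega>(1) D elim(2) diam this v] elim(1)
    show ?case by (simp add: g_def e_def pos_le_divide_eq mult.commute)
  qed
  then have "((\<lambda>\<delta>. (e \<delta>)\<^sup>2) \<longlongrightarrow> 0) at_top"
    by (intro tendsto_sandwich[OF _ _ tendsto_const g]) auto
  then have "((\<lambda>\<delta>. \<bar>e \<delta>\<bar>) \<longlongrightarrow> 0) at_top"
    using tendsto_real_sqrt[of "\<lambda>\<delta>. (e \<delta>)\<^sup>2"] by fastforce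
  then show ?thesis by (simp add: e_def tendsto_rabs_zero_iff)
qed

theorem theorem3:
  fixes \<Omega> :: "'a::euclidean_space set"
    and s :: real
    and f :: "'a \<Rightarrow> real"
    and u :: "real \<Rightarrow> 'a \<Rightarrow> real"
    and u_inf :: "'a \<Rightarrow> real"
  assumes "0 < s" and "s < 1"
    and "open \<Omega>" and "connected \<Omega>" and "\<Omega> \<noteq> {}" and "bounded \<Omega>"
    and "lipschitz_boundary \<Omega>"
    and "f \<in> L2 \<Omega>"
    and "\<And>\<delta>. 0 < \<delta> \<Longrightarrow> weak_solution_delta \<delta> s \<Omega> f (u \<delta>)"
    and "weak_solution_infinity s \<Omega> f u_inf"
  shows "\<forall>\<delta> :: nat \<Rightarrow> real. (\<forall>j. 0 < \<delta> j) \<and> filterlim \<delta> at_top sequentially \<longrightarrow>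
           (\<exists>r :: nat \<Rightarrow> nat. strict_mono r \<and>
              (\<lambda>j. L2_norm \<Omega> (\<lambda>x. u (\<delta> (r j)) x - u_inf x)) \<longlonglongrightarrow> 0)"
proof (intro allI impI)
  fix \<delta> :: "nat \<Rightarrow> real"
  assume "(\<forall>j. 0 < \<delta> j) \<and> filterlim \<delta> at_top sequentially"
  then have "(\<lambda>j. L2_norm \<Omega> (\<lambda>x. u (\<delta> j) x - u_inf x)) \<longlonglongrightarrow> 0"
    using filterlim_compose[OF weak_solution_tendsto[OF assms(1,2,3,6,9,10)]] by blast
  \<comment> \<open>The full sequence converges already, so the identity serves as the
    subsequence.\<close>
  then show "\<exists>r :: nat \<Rightarrow> nat. strict_mono r \<and>
      (\<lambda>j. L2_norm \<Omega> (\<lambda>x. u (\<delta> (r j)) x - u_inf x)) \<longlonglongrightarrow> 0"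
    by (intro exI[of _ id]) (simp add: strict_mono_def)
qed

end
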